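(* Let $k\ge2$. For every $R>0$, $$\mu_0\bigl(\{L\in X_k:\rho(\mathfrak{P},L)=R\}\bigr)=0.$$
   Context: $X_k$ is the set of all ($k$-dimensional) lattices $L\subset\mathbb{R}^k$ of covolume one, identified with $\mathrm{SL}(k,\mathbb{Z})\backslash\mathrm{SL}(k,\mathbb{R})$ via $\mathrm{SL}(k,\mathbb{Z})M\mapsto\mathbb{Z}^kM$ (row vectors), and $\mu_0$ is the $\mathrm{SL}(k,\mathbb{R})$-invariant probability measure on $X_k$. $\mathfrak{P}=\{x\in\mathbb{R}^k:|x_1|+\cdots+|x_k|\le1\}$, and $\rho(\mathfrak{P},L)=\inf\{r>0: r\mathfrak{P}+L=\mathbb{R}^k\}$ is the covering radius of $\mathfrak{P}$ with respect to $L$. *)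

theory Defs
  imports "HOL-Probability.Probability_Measure"
begin

section \<open>Lattices\<close>

text \<open>Vectors are row vectors: a matrix \<open>M\<close> acts by \<open>x \<mapsto> x v* M\<close>, and \<open>\<int>\<^sup>k M\<close> is the integer span
  of the rows of \<open>M\<close>.\<close>

definition integer_vectors :: "(real^'k) set" where
  "integer_vectors = {x. \<forall>i. x $ i \<in> \<int>}"

definition lattice_of :: "real^'k^'k \<Rightarrow> (real^'k) set" where
  "lattice_of M = (\<lambda>x. x v* M) ` integer_vectors"

definition is_lattice :: "(real^'k) set \<Rightarrow> bool" where
  "is_lattice L \<longleftrightarrow> (\<exists>M. invertible M \<and> L = lattice_of M)"

text \<open>The value does not depend on the chosen basis; see \<open>covolume_lattice_of\<close>.\<close>

definition covolume :: "(real^'k) set \<Rightarrow> real" where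
  "covolume L = \<bar>det (SOME M. invertible M \<and> L = lattice_of M)\<bar>"

definition unimodular_lattices :: "(real^'k) set set" where
  "unimodular_lattices = {L. is_lattice L \<and> covolume L = 1}"

definition SL_real :: "(real^'k^'k) set" where
  "SL_real = {M. det M = 1}"

definition SL_int :: "(real^'k^'k) set" where
  "SL_int = {M. det M = 1 \<and> (\<forall>i j. M $ i $ j \<in> \<int>)}"

lemma integer_vectors_mult:
  assumes "x \<in> integer_vectors" "\<And>i j. A $ i $ j \<in> \<int>"
  shows "x v* A \<in> integer_vectors"
  using assms by (auto simp: integer_vectors_def vector_matrix_mult_def intro!: Ints_sum Ints_mult)

lemma row_eq_axis_mult: "axis i 1 v* (M :: real^'k^'k) = M $ i"
  by (simp add: vec_eq_iff vector_matrix_mult_def axis_def if_distrib[of "\<lambda>c. c * _"] cong: if_cong)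

lemma lattice_of_subset_imp:
  fixes M N :: "real^'k^'k"
  assumes "lattice_of M \<subseteq> lattice_of N"
  obtains A :: "real^'k^'k" where "\<And>i j. A $ i $ j \<in> \<int>" "M = A ** N"
proof -
  have "\<exists>y. y \<in> integer_vectors \<and> M $ i = y v* N" for i
  proof -
    have "axis i 1 \<in> (integer_vectors :: (real^'k) set)"
      by (auto simp: integer_vectors_def axis_def)
    then have "M $ i \<in> lattice_of M"
      unfolding lattice_of_def using row_eq_axis_mult[of i M] by (metis imageI)
    with assms show ?thesis by (auto simp: lattice_of_def)
  qed
  then obtain y where y: "\<And>i. y i \<in> integer_vectors" "\<And>i. M $ i = y i v* N"
    by metis
  define A :: "real^'k^'k" where "A = (\<chi> i. y i)"
  have "A $ i $ j \<in> \<int>" for i j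
    using y(1)[of i] by (auto simp: A_def integer_vectors_def)
  moreover have "M = A ** N"
    by (simp add: vec_eq_iff y(2) A_def matrix_matrix_mult_def vector_matrix_mult_def)
  ultimately show thesis by (rule that)
qed

lemma lattice_of_mult_subset:
  assumes "\<And>i j. A $ i $ j \<in> \<int>"
  shows "lattice_of (A ** M) \<subseteq> lattice_of M"
  using integer_vectors_mult[OF _ assms]
  by (auto simp: lattice_of_def simp flip: vector_matrix_mul_assoc)

lemma det_integral:
  fixes A :: "real^'k^'k"
  assumes "\<And>i j. A $ i $ j \<in> \<int>"
  shows "det A \<in> \<int>"
  unfolding det_def using assms by (auto intro!: Ints_sum Ints_mult Ints_prod)

lemma abs_det_lattice_of:
  fixes M N :: "real^'k^'k"
  assumes "invertible M" "lattice_of M = lattice_of N"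
  shows "\<bar>det M\<bar> = \<bar>det N\<bar>"
proof -
  obtain A where A: "\<And>i j. A $ i $ j \<in> \<int>" "M = A ** N"
    using lattice_of_subset_imp[OF equalityD1[OF assms(2)]] by blast
  obtain B where B: "\<And>i j. B $ i $ j \<in> \<int>" "N = B ** M"
    using lattice_of_subset_imp[OF equalityD2[OF assms(2)]] by blast
  have dM: "det M \<noteq> 0" using assms(1) by (simp add: invertible_det_nz)
  have dMA: "det M = det A * det N" by (subst A(2)) (rule det_mul)
  have dNB: "det N = det B * det M" by (subst B(2)) (rule det_mul)
  have "det M = (det A * det B) * det M"
    using dMA unfolding dNB by (simp only: mult.assoc)
  then have eq: "det A * det B = 1" using dM by (metis mult_cancel_right1)
  then have nz: "det A \<noteq> 0" "det B \<noteq> 0" by auto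
  have "\<bar>det A\<bar> \<ge> 1" "\<bar>det B\<bar> \<ge> 1"
    using det_integral[OF A(1)] det_integral[OF B(1)] nz by (auto intro!: Ints_nonzero_abs_ge1)
  moreover have "\<bar>det A\<bar> * \<bar>det B\<bar> = 1" using eq by (simp flip: abs_mult)
  ultimately have "\<bar>det A\<bar> = 1"
    using mult_left_mono[of 1 "\<bar>det B\<bar>" "\<bar>det A\<bar>"] by simp
  then show ?thesis unfolding dMA abs_mult by simp
qed

lemma covolume_lattice_of:
  assumes "invertible M"
  shows "covolume (lattice_of M) = \<bar>det M\<bar>"
proof -
  define N where "N = (SOME N. invertible N \<and> lattice_of M = lattice_of N)"
  have "invertible N \<and> lattice_of M = lattice_of N"
    unfolding N_def by (rule someI[of _ M]) (simp add: assms)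
  then have "\<bar>det M\<bar> = \<bar>det N\<bar>"
    using abs_det_lattice_of[OF assms] by blast
  then show ?thesis
    unfolding covolume_def N_def by (rule sym)
qed

text \<open>The next two lemmas are the identification of the space of unimodular lattices with
  \<open>SL(k,\<int>)\SL(k,\<real>)\<close>.\<close>

lemma unimodular_lattices_eq: "unimodular_lattices = lattice_of ` (SL_real :: (real^'k^'k) set)"
proof
  show "lattice_of ` SL_real \<subseteq> (unimodular_lattices :: (real^'k) set set)"
  proof (rule image_subsetI)
    fix M :: "real^'k^'k" assume "M \<in> SL_real"
    then have "det M = 1" by (simp add: SL_real_def)
    moreover from this have "invertible M" by (simp add: invertible_det_nz)
    ultimately show "lattice_of M \<in> unimodular_lattices"
      by (auto simp: unimodular_lattices_def is_lattice_def covolume_lattice_of)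
  qed
  show "unimodular_lattices \<subseteq> lattice_of ` (SL_real :: (real^'k^'k) set)"
  proof
    fix L :: "(real^'k) set" assume "L \<in> unimodular_lattices"
    then obtain M where M: "invertible M" "L = lattice_of M" "\<bar>det M\<bar> = 1"
      by (auto simp: unimodular_lattices_def is_lattice_def covolume_lattice_of)
    show "L \<in> lattice_of ` SL_real"
    proof (cases "det M = 1")
      case True
      with M show ?thesis by (auto simp: SL_real_def)
    next
      case False
      with M have dM: "det M = -1" by linarith
      define i0 :: 'k where "i0 = undefined"
      define d :: "'k \<Rightarrow> real" where "d = (\<lambda>i. if i = i0 then -1 else 1)"
      define D :: "real^'k^'k" where "D = (\<chi> i j. if i = j then d i else 0)"
      have D: "D $ i $ j \<in> \<int>" for i j by (auto simp: D_def d_def)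
      have "det D = prod d UNIV"
        by (subst det_diagonal) (auto simp: D_def)
      also have "\<dots> = -1"
        by (simp add: d_def prod.delta)
      finally have dD: "det D = -1" .
      have DD: "D ** D = mat 1"
      proof -
        have "D $ i $ k * D $ k $ j = (if k = i then d i * D $ i $ j else 0)" for i j k
          by (simp add: D_def)
        then have "(D ** D) $ i $ j = (\<Sum>k\<in>UNIV. if k = i then d i * D $ i $ j else 0)" for i j
          by (simp add: matrix_matrix_mult_def)
        then have "(D ** D) $ i $ j = d i * D $ i $ j" for i j by simp
        then show ?thesis by (auto simp: vec_eq_iff D_def d_def mat_def)
      qed
      have "lattice_of (D ** M) = lattice_of M"
        using lattice_of_mult_subset[of D M] lattice_of_mult_subset[of D "D ** M"] D
        by (auto simp: matrix_mul_assoc DD)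
      moreover have "D ** M \<in> SL_real" by (simp add: SL_real_def det_mul dD dM)
      ultimately show ?thesis using M(2) by blast
    qed
  qed
qed

lemma lattice_of_eq_iff:
  fixes M N :: "real^'k^'k"
  assumes "M \<in> SL_real" "N \<in> SL_real"
  shows "lattice_of M = lattice_of N \<longleftrightarrow> (\<exists>A\<in>SL_int. M = A ** N)"
proof
  assume eq: "lattice_of M = lattice_of N"
  obtain A where A: "\<And>i j. A $ i $ j \<in> \<int>" "M = A ** N"
    using lattice_of_subset_imp[OF equalityD1[OF eq]] by blast
  then have "det A = 1"
    using assms by (simp add: SL_real_def det_mul)
  with A show "\<exists>A\<in>SL_int. M = A ** N" by (auto simp: SL_int_def)
next
  assume "\<exists>A\<in>SL_int. M = A ** N"
  then obtain A where A: "A \<in> SL_int" "M = A ** N" by auto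
  have sub: "lattice_of M \<subseteq> lattice_of N"
    using A lattice_of_mult_subset[of A N] by (auto simp: SL_int_def)
  define B :: "real^'k^'k" where "B = (\<chi> i j. det (\<chi> k l. if l = i then axis j 1 $ k else A $ k $ l))"
  have B: "B $ i $ j \<in> \<int>" for i j
    using A(1) by (auto simp: B_def SL_int_def axis_def intro!: det_integral)
  have "A *v column j B = axis j 1" for j
  proof -
    have "column j B = (\<chi> i. det (\<chi> k l. if l = i then axis j 1 $ k else A $ k $ l) / det A)"
      using A(1) by (simp add: column_def B_def SL_int_def)
    moreover have "det A \<noteq> 0" using A(1) by (simp add: SL_int_def)
    ultimately show ?thesis using cramer by blast
  qed
  moreover have "(A ** B) $ i $ j = (A *v column j B) $ i" for i j
    by (simp add: matrix_matrix_mult_def matrix_vector_mult_def column_def)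
  ultimately have AB: "A ** B = mat 1"
    by (simp add: vec_eq_iff mat_def axis_def)
  then have "B ** A = mat 1" by (simp add: matrix_left_right_inverse)
  then have "N = B ** M" by (simp add: A(2) matrix_mul_assoc)
  with B have "lattice_of N \<subseteq> lattice_of M"
    using lattice_of_mult_subset[of B M] by simp
  with sub show "lattice_of M = lattice_of N" by simp
qed

section \<open>Invariant probability measure\<close>

definition lattice_topology :: "(real^'k) set topology" where
  "lattice_topology = topology (\<lambda>U. U \<subseteq> unimodular_lattices \<and>
     openin (top_of_set SL_real) {M \<in> SL_real. lattice_of M \<in> U})"

lemma openin_lattice_topology:
  "openin lattice_topology U \<longleftrightarrow> U \<subseteq> unimodular_lattices \<and>
     openin (top_of_set SL_real) {M \<in> SL_real. lattice_of M \<in> U}"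
proof -
  have istop: "istopology (\<lambda>U. U \<subseteq> unimodular_lattices \<and>
     openin (top_of_set SL_real) {M \<in> (SL_real :: (real^'k^'k) set). lattice_of M \<in> U})"
    unfolding istopology_def
  proof (intro conjI allI impI; (elim conjE)?)
    fix S T :: "(real^'k) set set"
    assume "openin (top_of_set SL_real) {M \<in> SL_real. lattice_of M \<in> S}"
      "openin (top_of_set SL_real) {M \<in> SL_real. lattice_of M \<in> T}"
    then have "openin (top_of_set SL_real)
      ({M \<in> SL_real. lattice_of M \<in> S} \<inter> {M \<in> SL_real. lattice_of M \<in> T})" by (rule openin_Int)
    then show "openin (top_of_set SL_real) {M \<in> SL_real. lattice_of M \<in> S \<inter> T}"
      by (rule back_subst) auto
  next
    fix K :: "(real^'k) set set set"
    assume "\<forall>U\<in>K. U \<subseteq> unimodular_lattices \<and>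
      openin (top_of_set SL_real) {M \<in> SL_real. lattice_of M \<in> U}"
    then have "openin (top_of_set SL_real) (\<Union>U\<in>K. {M \<in> SL_real. lattice_of M \<in> U})"
      by (intro openin_Union) auto
    then show "openin (top_of_set SL_real) {M \<in> SL_real. lattice_of M \<in> \<Union>K}"
      by (rule back_subst) auto
  qed auto
  show ?thesis
    unfolding lattice_topology_def topology_inverse'[OF istop] ..
qed

lemma quotient_map_lattice_of:
  "quotient_map (top_of_set SL_real) (lattice_topology :: (real^'k) set topology) lattice_of"
proof -
  have "openin lattice_topology (unimodular_lattices :: (real^'k) set set)"
  proof -
    have "{M \<in> SL_real. lattice_of M \<in> unimodular_lattices} = (SL_real :: (real^'k^'k) set)"
      by (auto simp: unimodular_lattices_eq)
    then show ?thesis by (simp add: openin_lattice_topology openin_subtopology_self)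
  qed
  then have "topspace lattice_topology = (unimodular_lattices :: (real^'k) set set)"
    by (meson openin_lattice_topology openin_subset openin_topspace subset_antisym)
  then show ?thesis
    by (auto simp: quotient_map_def openin_lattice_topology unimodular_lattices_eq)
qed

definition lattice_borel :: "(real^'k) set measure" where
  "lattice_borel = sigma unimodular_lattices {U. openin lattice_topology U}"

definition lattice_action :: "real^'k^'k \<Rightarrow> (real^'k) set \<Rightarrow> (real^'k) set" where
  "lattice_action g L = (\<lambda>x. x v* g) ` L"

definition invariant_probability :: "(real^'k) set measure \<Rightarrow> bool" where
  "invariant_probability \<mu> \<longleftrightarrow>
     prob_space \<mu> \<and> sets \<mu> = sets lattice_borel \<and>
     (\<forall>g\<in>SL_real. \<forall>A\<in>sets \<mu>. emeasure \<mu> (lattice_action g ` A) = emeasure \<mu> A)"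

section \<open>Covering radius\<close>

definition cross_polytope :: "(real^'k) set" where
  "cross_polytope = {x. (\<Sum>i\<in>UNIV. \<bar>x $ i\<bar>) \<le> 1}"

definition covering_radius :: "(real^'k) set \<Rightarrow> (real^'k) set \<Rightarrow> real" where
  "covering_radius P L = Inf {r. r > 0 \<and> {r *\<^sub>R x + y | x y. x \<in> P \<and> y \<in> L} = UNIV}"

end

theory Submission
  imports Defs "HOL-Computational_Algebra.Polynomial"
begin

text \<open>
  Write \<open>\<rho>(L)\<close> for the covering radius of the cross-polytope, the unit ball of the \<open>l\<^sub>1\<close> norm. The proof
  rests on two facts: \<open>\<rho>\<close> is piecewise linear in a basis of the lattice, and a nonzero level of a
  linear form is met only finitely often along a suitable diagonal curve in \<open>SL(k,\<real>)\<close>.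

  If \<open>\<rho>(\<int>\<^sup>k M) = R\<close>, compactness gives a deep hole: a point \<open>x\<close> at distance exactly \<open>R\<close> from the lattice,
  the largest distance possible. For every nearest lattice point \<open>v\<close> choose a sign vector \<open>e\<close> with
  \<open>e \<bullet> (x - v) = R\<close>. If \<open>0\<close> were not in the convex hull of these sign vectors, a separating
  direction would lead from \<open>x\<close> away from all nearest lattice points at once and produce a deeper
  hole (\<open>deep_hole_zero_in_convex_hull\<close>). So \<open>0 = \<Sum>\<^sub>e u\<^sub>e e\<close> with \<open>\<Sum>\<^sub>e u\<^sub>e = 1\<close>, and summing the equations
  \<open>e \<bullet> (x - v) = R\<close> with the weights \<open>u\<^sub>e\<close> eliminates \<open>x\<close>. What remains expresses \<open>R\<close> as the value at
  \<open>M\<close> of a linear form that is determined by a set of sign vectors and one short integer vector for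
  each of them (\<open>covering_radius_eq_linear_form\<close>).

  Now let \<open>D(s)\<close> be diagonal with one entry \<open>s\<^bsup>-(k-1)\<^esup>\<close> and the others \<open>s\<close>. For \<open>1 \<le> s \<le> 2\<close> only finitely
  many of these forms can be relevant to \<open>M D(s)\<close>, and each gives an equation
  \<open>a s + b s\<^bsup>-(k-1)\<^esup> = R\<close>. As \<open>k \<ge> 2\<close> and \<open>R \<noteq> 0\<close>, it is a nontrivial polynomial equation. Hence for each
  lattice \<open>L\<close> there are only finitely many \<open>s \<in> [1,2]\<close> with \<open>\<rho>(L D(s)) = R\<close>
  (\<open>finite_stretch_covering_radius\<close>).

  Finally, for distinct \<open>s\<^sub>0, s\<^sub>1, \<dots>\<close> in \<open>[1,2]\<close> the translates of the level set by \<open>D(s\<^sub>n)\<^bsup>-1\<^esup>\<close> all have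
  the same measure by invariance, while every lattice lies in only finitely many of them. In a finite
  measure space this forces the common measure to be \<open>0\<close> (\<open>emeasure_zero_if_finitely_often\<close>).
\<close>

section \<open>The \<open>l\<^sub>1\<close> norm and sign vectors\<close>

definition l1_norm :: "real^'k \<Rightarrow> real" where
  "l1_norm x = (\<Sum>i\<in>UNIV. \<bar>x $ i\<bar>)"

definition sign_vectors :: "(real^'k) set" where
  "sign_vectors = {e. \<forall>i. e $ i \<in> {-1, 1}}"

lemma l1_norm_nonneg [simp]: "0 \<le> l1_norm x"
  by (simp add: l1_norm_def sum_nonneg)

lemma l1_norm_minus [simp]: "l1_norm (- x) = l1_norm x"
  by (simp add: l1_norm_def)

lemma l1_norm_minus_commute: "l1_norm (x - y) = l1_norm (y - x)"
  by (simp add: l1_norm_def abs_minus_commute)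

lemma l1_norm_triangle: "l1_norm (x + y) \<le> l1_norm x + l1_norm y"
  by (simp add: l1_norm_def sum_mono flip: sum.distrib)

lemma l1_norm_scaleR: "l1_norm (c *\<^sub>R x) = \<bar>c\<bar> * l1_norm x"
  by (simp add: l1_norm_def abs_mult sum_distrib_left)

lemma component_le_l1_norm: "\<bar>x $ i\<bar> \<le> l1_norm x"
  unfolding l1_norm_def by (rule member_le_sum) auto

lemma l1_norm_vector_matrix_le:
  fixes A :: "real^'k^'k"
  shows "l1_norm (x v* A) \<le> (\<Sum>i\<in>UNIV. l1_norm (A $ i)) * l1_norm x"
proof -
  have "l1_norm (x v* A) \<le> (\<Sum>j\<in>UNIV. \<Sum>i\<in>UNIV. \<bar>x $ i\<bar> * \<bar>A $ i $ j\<bar>)"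
    unfolding l1_norm_def vector_matrix_mult_def
    by (auto intro!: sum_mono order_trans[OF sum_abs] simp: abs_mult)
  also have "\<dots> = (\<Sum>i\<in>UNIV. \<bar>x $ i\<bar> * l1_norm (A $ i))"
    by (subst sum.swap) (simp add: l1_norm_def sum_distrib_left)
  also have "\<dots> \<le> (\<Sum>i\<in>UNIV. l1_norm x * l1_norm (A $ i))"
    by (intro sum_mono mult_right_mono component_le_l1_norm) simp
  finally show ?thesis by (simp add: mult.commute flip: sum_distrib_left)
qed

lemma finite_sign_vectors [simp]: "finite (sign_vectors :: (real^'k) set)"
proof -
  have "vec_nth ` sign_vectors \<subseteq> (UNIV :: 'k set) \<rightarrow>\<^sub>E {-1, 1 :: real}"
    by (auto simp: sign_vectors_def PiE_def Pi_def)
  then have "finite (vec_nth ` (sign_vectors :: (real^'k) set))"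
    by (rule finite_subset) (intro finite_PiE; simp)
  then show ?thesis
    by (rule finite_imageD) (simp add: inj_on_def vec_eq_iff)
qed

text \<open>The \<open>l\<^sub>1\<close> norm is the maximum of the linear forms given by the sign vectors, which are the outer
  normals of the facets of the cross-polytope.\<close>

lemma sign_inner_le_l1_norm:
  assumes "e \<in> sign_vectors"
  shows "e \<bullet> x \<le> l1_norm x"
  unfolding inner_vec_def l1_norm_def
proof (rule sum_mono)
  fix i
  have "e $ i = -1 \<or> e $ i = 1" using assms by (auto simp: sign_vectors_def)
  then show "e $ i \<bullet> x $ i \<le> \<bar>x $ i\<bar>" by (auto simp: inner_real_def)
qed

lemma exists_sign_inner_eq_l1_norm: "\<exists>e\<in>sign_vectors. e \<bullet> x = l1_norm x"
proof
  define e :: "real^'a" where "e = (\<chi> i. if x $ i \<ge> 0 then 1 else -1)"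
  show "e \<in> sign_vectors" by (simp add: sign_vectors_def e_def)
  show "e \<bullet> x = l1_norm x"
    unfolding inner_vec_def l1_norm_def by (rule sum.cong) (auto simp: e_def)
qed

section \<open>Lattices are discrete, cocompact groups\<close>

lemma lattice_add_closed: "v \<in> lattice_of M \<Longrightarrow> w \<in> lattice_of M \<Longrightarrow> v + w \<in> lattice_of M"
proof -
  assume "v \<in> lattice_of M" "w \<in> lattice_of M"
  then obtain a b where "a \<in> integer_vectors" "b \<in> integer_vectors" "v = a v* M" "w = b v* M"
    by (auto simp: lattice_of_def)
  then show ?thesis unfolding lattice_of_def
    by (intro image_eqI[of _ _ "a + b"])
       (auto simp: integer_vectors_def vector_matrix_left_distrib)
qed

lemma lattice_diff_closed: "v \<in> lattice_of M \<Longrightarrow> w \<in> lattice_of M \<Longrightarrow> v - w \<in> lattice_of M"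
proof -
  assume "v \<in> lattice_of M" "w \<in> lattice_of M"
  then obtain a b where "a \<in> integer_vectors" "b \<in> integer_vectors" "v = a v* M" "w = b v* M"
    by (auto simp: lattice_of_def)
  then show ?thesis unfolding lattice_of_def
    by (intro image_eqI[of _ _ "a - b"])
       (auto simp: integer_vectors_def vector_matrix_mult_diff_distrib)
qed

lemma finite_bounded_integer_vectors:
  "finite {z :: real^'k. z \<in> integer_vectors \<and> l1_norm z \<le> C}"
proof -
  let ?Z = "{z :: real^'k. z \<in> integer_vectors \<and> l1_norm z \<le> C}"
  have "vec_nth ` ?Z \<subseteq> (UNIV :: 'k set) \<rightarrow>\<^sub>E {t \<in> \<int>. \<bar>t\<bar> \<le> C}"
    by (auto simp: integer_vectors_def PiE_def Pi_def intro: order_trans[OF component_le_l1_norm])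
  moreover have "finite ((UNIV :: 'k set) \<rightarrow>\<^sub>E {t \<in> \<int>. \<bar>t :: real\<bar> \<le> C})"
    by (intro finite_PiE finite_abs_int_segment) auto
  ultimately have "finite (vec_nth ` ?Z)" by (rule finite_subset)
  then show ?thesis
    by (rule finite_imageD) (simp add: inj_on_def vec_eq_iff)
qed

text \<open>Multiplying by the inverse of \<open>M\<close> bounds the coordinates of a lattice vector by its length.\<close>

lemma finite_short_coordinates:
  fixes M :: "real^'k^'k"
  assumes "invertible M"
  shows "finite {z. z \<in> integer_vectors \<and> l1_norm (z v* M) \<le> C}"
proof -
  obtain N where N: "M ** N = mat 1" using assms by (auto simp: invertible_def)
  define B where "B = (\<Sum>i\<in>UNIV. l1_norm (N $ i))"
  have B: "B \<ge> 0" by (simp add: B_def sum_nonneg)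
  have "l1_norm z \<le> B * C" if "l1_norm (z v* M) \<le> C" for z
  proof -
    have "l1_norm z = l1_norm ((z v* M) v* N)" by (simp add: vector_matrix_mul_assoc N)
    also have "\<dots> \<le> B * l1_norm (z v* M)" unfolding B_def by (rule l1_norm_vector_matrix_le)
    also have "\<dots> \<le> B * C" using B that by (rule mult_left_mono[rotated])
    finally show ?thesis .
  qed
  then have "{z. z \<in> integer_vectors \<and> l1_norm (z v* M) \<le> C}
      \<subseteq> {z. z \<in> integer_vectors \<and> l1_norm z \<le> B * C}" by auto
  then show ?thesis by (rule finite_subset) (rule finite_bounded_integer_vectors)
qed

lemma finite_lattice_ball:
  assumes "invertible M"
  shows "finite {v \<in> lattice_of M. l1_norm (x - v) \<le> C}"
proof -
  let ?Z = "{z. z \<in> integer_vectors \<and> l1_norm (z v* M) \<le> l1_norm x + C}"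
  have "{v \<in> lattice_of M. l1_norm (x - v) \<le> C} \<subseteq> (\<lambda>z. z v* M) ` ?Z"
  proof
    fix v assume v: "v \<in> {v \<in> lattice_of M. l1_norm (x - v) \<le> C}"
    then obtain z where z: "z \<in> integer_vectors" "v = z v* M" by (auto simp: lattice_of_def)
    have "l1_norm v \<le> l1_norm x + l1_norm (v - x)"
      using l1_norm_triangle[of x "v - x"] by simp
    with v have "l1_norm v \<le> l1_norm x + C" by (simp add: l1_norm_minus_commute)
    with z show "v \<in> (\<lambda>z. z v* M) ` ?Z" by auto
  qed
  then show ?thesis
    by (rule finite_subset) (intro finite_imageI finite_short_coordinates assms)
qed

text \<open>Rounding down the coordinates with respect to the basis \<open>M\<close> moves every point into the
  fundamental cell, which is compact.\<close>

lemma lattice_cell_representative: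
  fixes M :: "real^'k^'k"
  assumes "invertible M"
  obtains w v where "w \<in> cbox 0 1" "v \<in> lattice_of M" "y - v = w v* M"
proof -
  obtain N where N: "N ** M = mat 1" using assms by (auto simp: invertible_def)
  define z :: "real^'k" where "z = (\<chi> i. of_int \<lfloor>(y v* N) $ i\<rfloor>)"
  define w where "w = y v* N - z"
  show thesis
  proof
    show "w \<in> cbox 0 1"
      by (auto simp: w_def z_def mem_box_cart) linarith
    show "z v* M \<in> lattice_of M"
      by (auto simp: lattice_of_def z_def integer_vectors_def)
    show "y - z v* M = w v* M"
      by (simp add: w_def vector_matrix_mult_diff_distrib vector_matrix_mul_assoc N)
  qed
qed

section \<open>The covering radius\<close>

text \<open>This is \<open>rP + L = \<real>\<^sup>k\<close>, where \<open>P\<close> is the cross-polytope, for positive \<open>r\<close>; see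
  \<open>covering_radius_cross_polytope\<close>.\<close>

definition covers :: "real \<Rightarrow> (real^'k) set \<Rightarrow> bool" where
  "covers r L \<longleftrightarrow> (\<forall>y. \<exists>v\<in>L. l1_norm (y - v) \<le> r)"

lemma covers_mono: "covers r L \<Longrightarrow> r \<le> s \<Longrightarrow> covers s L"
  unfolding covers_def by (meson order_trans)

lemma covering_radius_cross_polytope:
  "covering_radius cross_polytope L = Inf {r. r > 0 \<and> covers r L}"
proof -
  have "{r *\<^sub>R x + v | x v. x \<in> cross_polytope \<and> v \<in> L} = UNIV \<longleftrightarrow> covers r L" if "r > 0" for r
  proof -
    have "(\<exists>x v. y = r *\<^sub>R x + v \<and> x \<in> cross_polytope \<and> v \<in> L) \<longleftrightarrow> (\<exists>v\<in>L. l1_norm (y - v) \<le> r)"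
      for y
    proof
      assume "\<exists>x v. y = r *\<^sub>R x + v \<and> x \<in> cross_polytope \<and> v \<in> L"
      then obtain x v where "y = r *\<^sub>R x + v" "l1_norm x \<le> 1" "v \<in> L"
        unfolding cross_polytope_def l1_norm_def by blast
      then show "\<exists>v\<in>L. l1_norm (y - v) \<le> r"
        using that by (intro bexI[of _ v]) (auto simp: l1_norm_scaleR)
    next
      assume "\<exists>v\<in>L. l1_norm (y - v) \<le> r"
      then obtain v where v: "v \<in> L" "l1_norm (y - v) \<le> r" by auto
      have "l1_norm ((1 / r) *\<^sub>R (y - v)) \<le> 1"
        using v that by (subst l1_norm_scaleR) (simp add: field_simps)
      then show "\<exists>x v. y = r *\<^sub>R x + v \<and> x \<in> cross_polytope \<and> v \<in> L"
        using v that
        by (intro exI[of _ "(1 / r) *\<^sub>R (y - v)"] exI[of _ v])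
           (simp add: cross_polytope_def l1_norm_def)
    qed
    then show ?thesis unfolding covers_def by blast
  qed
  then have "{r. r > 0 \<and> {r *\<^sub>R x + v | x v. x \<in> cross_polytope \<and> v \<in> L} = UNIV}
      = {r. r > 0 \<and> covers r L}" by blast
  then show ?thesis by (simp add: covering_radius_def)
qed

lemma covering_radius_le:
  assumes "r > 0" "covers r L"
  shows "covering_radius cross_polytope L \<le> r"
  unfolding covering_radius_cross_polytope
  by (rule cInf_lower) (use assms in \<open>auto intro!: bdd_belowI[of _ 0]\<close>)

lemma exists_covers:
  fixes M :: "real^'k^'k"
  assumes "invertible M"
  shows "\<exists>r>0. covers r (lattice_of M)"
proof -
  define B where "B = (\<Sum>i\<in>UNIV. l1_norm (M $ i))"
  have B: "B \<ge> 0" by (simp add: B_def sum_nonneg)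
  have "covers (B * CARD('k)) (lattice_of M)"
    unfolding covers_def
  proof
    fix y
    obtain w v where w: "w \<in> cbox 0 1" "v \<in> lattice_of M" "y - v = w v* M"
      using lattice_cell_representative[OF assms] .
    have "l1_norm w \<le> (\<Sum>i\<in>(UNIV :: 'k set). 1)"
      unfolding l1_norm_def using w(1) by (intro sum_mono) (auto simp: mem_box_cart)
    then have "B * l1_norm w \<le> B * CARD('k)"
      using B by (intro mult_left_mono) simp_all
    then have "l1_norm (w v* M) \<le> B * CARD('k)"
      using l1_norm_vector_matrix_le[of w M] unfolding B_def by (rule order_trans[rotated])
    with w(2,3) show "\<exists>v\<in>lattice_of M. l1_norm (y - v) \<le> B * CARD('k)" by metis
  qed
  then have "covers (B * CARD('k) + 1) (lattice_of M)" by (rule covers_mono) simp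
  moreover have "B * CARD('k) + 1 > 0" using B by (simp add: add_nonneg_pos)
  ultimately show ?thesis by blast
qed

lemma covers_below:
  assumes "invertible M" "covering_radius cross_polytope (lattice_of M) < r"
  obtains s where "0 < s" "s < r" "covers s (lattice_of M)"
proof -
  have "{r. r > 0 \<and> covers r (lattice_of M)} \<noteq> {}"
    using exists_covers[OF assms(1)] by auto
  from cInf_lessD[OF this assms(2)[unfolded covering_radius_cross_polytope]] that
  show thesis by auto
qed

lemma not_covers_below:
  assumes "0 < covering_radius cross_polytope L" "r < covering_radius cross_polytope L"
  shows "\<not> covers r L"
proof
  assume "covers r L"
  define s where "s = max r (covering_radius cross_polytope L / 2)"
  have "covers s L" using \<open>covers r L\<close> by (rule covers_mono) (simp add: s_def)
  moreover have "s > 0" "s < covering_radius cross_polytope L" using assms by (auto simp: s_def)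
  ultimately show False using covering_radius_le by fastforce
qed

text \<open>For every \<open>r < R\<close> some point has distance more than \<open>r\<close> from the lattice. Translated into the
  fundamental cell, such points for \<open>r\<close> tending to \<open>R\<close> accumulate at a deep hole.\<close>

lemma deep_hole_exists:
  fixes M :: "real^'k^'k"
  assumes "invertible M" and R: "covering_radius cross_polytope (lattice_of M) = R" "R > 0"
  obtains x where "\<And>v. v \<in> lattice_of M \<Longrightarrow> R \<le> l1_norm (x - v)"
proof -
  define K where "K = (\<lambda>w. w v* M) ` cbox 0 (1 :: real^'k)"
  have "linear (\<lambda>w. w v* M)"
    by (auto intro!: linearI simp: vector_matrix_left_distrib scaleR_vector_matrix_assoc)
  then have "continuous_on (cbox 0 1) (\<lambda>w. w v* M)" by (rule linear_continuous_on[OF linear_linear[THEN iffD2]])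
  then have "compact K" unfolding K_def by (intro compact_continuous_image compact_cbox)
  have "\<exists>x\<in>K. \<forall>v\<in>lattice_of M. R - 1 / real (Suc n) \<le> l1_norm (x - v)" for n
  proof -
    have "\<not> covers (R - 1 / real (Suc n)) (lattice_of M)"
      using R by (intro not_covers_below) simp_all
    then obtain y where y: "\<And>v. v \<in> lattice_of M \<Longrightarrow> R - 1 / real (Suc n) < l1_norm (y - v)"
      unfolding covers_def by (auto simp: not_le)
    obtain w u where w: "w \<in> cbox 0 1" "u \<in> lattice_of M" "y - u = w v* M"
      using lattice_cell_representative[OF assms(1)] .
    have "y - u \<in> K" using w by (auto simp: K_def)
    moreover have "R - 1 / real (Suc n) \<le> l1_norm (y - u - v)" if "v \<in> lattice_of M" for v
      using y[OF lattice_add_closed[OF w(2) that]] by (simp add: diff_diff_add)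
    ultimately show ?thesis by blast
  qed
  then obtain x where x: "\<And>n. x n \<in> K"
    "\<And>n v. v \<in> lattice_of M \<Longrightarrow> R - 1 / real (Suc n) \<le> l1_norm (x n - v)"
    by metis
  obtain l \<sigma> where l: "strict_mono \<sigma>" "(x \<circ> \<sigma>) \<longlonglongrightarrow> l"
    using \<open>compact K\<close> x(1) unfolding compact_def by metis
  show thesis
  proof
    fix v assume v: "v \<in> lattice_of M"
    have "(\<lambda>n. R - 1 / real (Suc n)) \<longlonglongrightarrow> R - 0"
      by (intro tendsto_diff tendsto_const LIMSEQ_Suc[OF lim_1_over_n])
    then have "((\<lambda>n. R - 1 / real (Suc n)) \<circ> \<sigma>) \<longlonglongrightarrow> R"
      using l(1) by (intro LIMSEQ_subseq_LIMSEQ) simp_all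
    moreover have "(\<lambda>n. l1_norm ((x \<circ> \<sigma>) n - v)) \<longlonglongrightarrow> l1_norm (l - v)"
      unfolding l1_norm_def by (intro tendsto_intros l(2))
    ultimately show "R \<le> l1_norm (l - v)"
      by (rule LIMSEQ_le) (use x(2)[OF v] in auto)
  qed
qed

section \<open>The covering radius is locally a linear form in the basis\<close>

text \<open>A deep hole is a local maximum of the distance to the lattice. If \<open>e v \<bullet> h > 0\<close> for all
  nearest points \<open>v\<close>, then a small step along \<open>h\<close> increases the distance to each of them, and all other
  lattice points stay too far away to matter.\<close>

lemma deep_hole_zero_in_convex_hull:
  fixes M :: "real^'k^'k"
  assumes M: "invertible M" and R: "covering_radius cross_polytope (lattice_of M) = R" "R > 0"
    and x: "\<And>v. v \<in> lattice_of M \<Longrightarrow> R \<le> l1_norm (x - v)"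
    and A: "A = {v \<in> lattice_of M. l1_norm (x - v) = R}"
    and e: "\<And>v. v \<in> A \<Longrightarrow> e v \<in> sign_vectors \<and> e v \<bullet> (x - v) = R"
  shows "0 \<in> convex hull (e ` A)"
proof (rule ccontr)
  assume "0 \<notin> convex hull (e ` A)"
  moreover have "finite A"
    by (rule finite_subset[OF _ finite_lattice_ball[OF M, of x R]]) (auto simp: A)
  then have "closed (convex hull (e ` A))"
    by (intro compact_imp_closed finite_imp_compact_convex_hull) simp
  ultimately obtain h b where b: "b > 0" and h': "\<And>y. y \<in> convex hull (e ` A) \<Longrightarrow> h \<bullet> y > b"
    using separating_hyperplane_closed_0[OF convex_convex_hull] by metis
  have h: "e v \<bullet> h > b" if "v \<in> A" for v
    using h'[OF hull_inc, of "e v"] that by (simp add: inner_commute)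
  \<comment> \<open>By discreteness, the lattice points that are not nearest to \<open>x\<close> are farther away by a fixed gap.\<close>
  obtain d where d: "d > 0" "\<And>v. v \<in> lattice_of M - A \<Longrightarrow> R + d \<le> l1_norm (x - v)"
  proof -
    let ?B = "{v \<in> lattice_of M. l1_norm (x - v) \<le> R + 1} - A"
    define D where "D = insert 1 ((\<lambda>v. l1_norm (x - v) - R) ` ?B)"
    have fin: "finite D" unfolding D_def using finite_lattice_ball[OF M] by auto
    have "0 < t" if "t \<in> D" for t
      using that x unfolding D_def A by (auto simp: order_less_le)
    moreover have "D \<noteq> {}" by (simp add: D_def)
    ultimately have "Min D > 0" using fin by (simp add: Min_gr_iff)
    moreover have "R + Min D \<le> l1_norm (x - v)" if v: "v \<in> lattice_of M - A" for v
    proof (cases "l1_norm (x - v) \<le> R + 1")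
      case True
      then have "l1_norm (x - v) - R \<in> D" using v by (auto simp: D_def)
      then have "Min D \<le> l1_norm (x - v) - R" using fin by simp
      then show ?thesis by simp
    next
      case False
      moreover have "Min D \<le> 1" using fin by (simp add: D_def)
      ultimately show ?thesis by simp
    qed
    ultimately show thesis using that by blast
  qed
  \<comment> \<open>This step length ensures that moving by \<open>t h\<close> uses up at most half of the gap \<open>d\<close>.\<close>
  define t where "t = d / (2 * (l1_norm h + 1))"
  define c where "c = min (t * b) (d / 2)"
  have pos: "l1_norm h + 1 > 0" by (simp add: add_nonneg_pos)
  have t: "t > 0" unfolding t_def using d pos by simp
  have "t * l1_norm h \<le> t * (l1_norm h + 1)" using t by simp
  also have "\<dots> = d / 2" unfolding t_def using pos by (simp add: field_simps)
  finally have th: "t * l1_norm h \<le> d / 2" .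
  have far: "R + c \<le> l1_norm (x + t *\<^sub>R h - v)" if v: "v \<in> lattice_of M" for v
  proof (cases "v \<in> A")
    case True
    have "R + t * b \<le> e v \<bullet> (x - v) + t * (e v \<bullet> h)"
      using e[OF True] h[OF True] t by simp
    also have "\<dots> = e v \<bullet> (x + t *\<^sub>R h - v)" by (simp add: inner_simps)
    also have "\<dots> \<le> l1_norm (x + t *\<^sub>R h - v)"
      using e[OF True] by (intro sign_inner_le_l1_norm) simp
    finally show ?thesis by (simp add: c_def)
  next
    case False
    have "l1_norm (x - v) \<le> l1_norm (x + t *\<^sub>R h - v) + l1_norm ((- t) *\<^sub>R h)"
      using l1_norm_triangle[of "x + t *\<^sub>R h - v" "(- t) *\<^sub>R h"] by (simp add: algebra_simps)
    then have "l1_norm (x - v) \<le> l1_norm (x + t *\<^sub>R h - v) + t * l1_norm h"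
      using t by (simp add: l1_norm_scaleR)
    with d(2)[of v] th v False show ?thesis by (simp add: c_def)
  qed
  have "c > 0" using t b d by (simp add: c_def)
  then obtain s where s: "s < R + c" "covers s (lattice_of M)"
    using covers_below[OF M, of "R + c"] R by auto
  then obtain v where "v \<in> lattice_of M" "l1_norm (x + t *\<^sub>R h - v) \<le> s"
    unfolding covers_def by blast
  with far s(1) show False by fastforce
qed

text \<open>Fixing the weights by choice, as a function of the set \<open>E\<close> alone, leaves only finitely many weight
  functions for the finitely many sets of sign vectors.\<close>

definition balancing_weights :: "(real^'k) set \<Rightarrow> real^'k \<Rightarrow> real" where
  "balancing_weights E = (SOME u. sum u E = 1 \<and> (\<Sum>e\<in>E. u e *\<^sub>R e) = 0)"

lemma balancing_weights:
  assumes "finite E" "0 \<in> convex hull E"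
  shows "sum (balancing_weights E) E = 1" "(\<Sum>e\<in>E. balancing_weights E e *\<^sub>R e) = 0"
proof -
  have "\<exists>u. sum u E = 1 \<and> (\<Sum>e\<in>E. u e *\<^sub>R e) = 0"
    using assms by (auto simp: convex_hull_finite)
  then have "sum (balancing_weights E) E = 1 \<and> (\<Sum>e\<in>E. balancing_weights E e *\<^sub>R e) = 0"
    unfolding balancing_weights_def by (rule someI_ex)
  then show "sum (balancing_weights E) E = 1" "(\<Sum>e\<in>E. balancing_weights E e *\<^sub>R e) = 0"
    by auto
qed

text \<open>Summing \<open>e \<bullet> (x - v\<^sub>e) = R\<close> with balancing weights removes \<open>x\<close>. Subtracting the \<open>v\<^sub>e\<close> from a fixed
  nearest point \<open>v\<^sub>0\<close> changes nothing in the sum, and it bounds the lattice vectors \<open>v\<^sub>0 - v\<^sub>e\<close> that occur by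
  \<open>2R\<close>.\<close>

lemma covering_radius_eq_linear_form:
  fixes M :: "real^'k^'k"
  assumes M: "invertible M" and R: "covering_radius cross_polytope (lattice_of M) = R" "R > 0"
  obtains E z where "E \<subseteq> sign_vectors"
    and "\<And>e. e \<in> E \<Longrightarrow> z e \<in> integer_vectors \<and> l1_norm (z e v* M) \<le> 2 * R"
    and "R = (\<Sum>e\<in>E. balancing_weights E e * (e \<bullet> (z e v* M)))"
proof -
  obtain x where x: "\<And>v. v \<in> lattice_of M \<Longrightarrow> R \<le> l1_norm (x - v)"
    using deep_hole_exists[OF M R] by blast
  define A where "A = {v \<in> lattice_of M. l1_norm (x - v) = R}"
  obtain \<epsilon> where \<epsilon>: "\<And>v. \<epsilon> v \<in> sign_vectors \<and> \<epsilon> v \<bullet> (x - v) = l1_norm (x - v)"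
    using choice[of "\<lambda>v e. e \<in> sign_vectors \<and> e \<bullet> (x - v) = l1_norm (x - v)"]
      exists_sign_inner_eq_l1_norm by blast
  define E where "E = \<epsilon> ` A"
  have E: "E \<subseteq> sign_vectors" using \<epsilon> by (auto simp: E_def)
  have hull: "0 \<in> convex hull E"
    unfolding E_def by (rule deep_hole_zero_in_convex_hull[OF M R x A_def]) (use \<epsilon> in \<open>auto simp: A_def\<close>)
  note u = balancing_weights[OF finite_subset[OF E finite_sign_vectors] hull]
  have "E \<noteq> {}" using u(1) by auto
  then obtain v0 where v0: "v0 \<in> A" by (auto simp: E_def)
  have "\<exists>z. z \<in> integer_vectors \<and> l1_norm (z v* M) \<le> 2 * R \<and> e \<bullet> (z v* M) = R + e \<bullet> (v0 - x)"
    if e: "e \<in> E" for e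
  proof -
    obtain v where v: "v \<in> A" "\<epsilon> v = e" using e by (auto simp: E_def)
    have "v0 - v \<in> lattice_of M" using v v0 by (intro lattice_diff_closed) (auto simp: A_def)
    then obtain z where z: "z \<in> integer_vectors" "v0 - v = z v* M" by (auto simp: lattice_of_def)
    have "l1_norm (v0 - v) \<le> l1_norm (v0 - x) + l1_norm (x - v)"
      using l1_norm_triangle[of "v0 - x" "x - v"] by simp
    also have "\<dots> = 2 * R" using v v0 by (simp add: A_def l1_norm_minus_commute[of v0])
    finally have "l1_norm (v0 - v) \<le> 2 * R" .
    moreover have "e \<bullet> (x - v) = R" using \<epsilon>[of v] v by (simp add: A_def)
    then have "e \<bullet> (v0 - v) = R + e \<bullet> (v0 - x)" by (simp add: inner_diff_right)
    ultimately show ?thesis using z by auto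
  qed
  then obtain z where z: "\<And>e. e \<in> E \<Longrightarrow> z e \<in> integer_vectors \<and> l1_norm (z e v* M) \<le> 2 * R"
    "\<And>e. e \<in> E \<Longrightarrow> e \<bullet> (z e v* M) = R + e \<bullet> (v0 - x)"
    by metis
  have "(\<Sum>e\<in>E. balancing_weights E e * (e \<bullet> (z e v* M)))
      = (\<Sum>e\<in>E. balancing_weights E e * R + (balancing_weights E e *\<^sub>R e) \<bullet> (v0 - x))"
    by (rule sum.cong) (simp_all add: z(2) distrib_left)
  also have "\<dots> = sum (balancing_weights E) E * R
      + (\<Sum>e\<in>E. balancing_weights E e *\<^sub>R e) \<bullet> (v0 - x)"
    by (simp only: sum.distrib sum_distrib_right inner_sum_left)
  also have "\<dots> = R" using u by simp
  finally show thesis using that[OF E z(1)] by simp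
qed

section \<open>Stretching a lattice along a diagonal curve\<close>

text \<open>The exponent makes the determinant \<open>1\<close>. The two entries are \<open>s\<close> and a negative power of \<open>s\<close>, so that a
  linear combination of them cannot be a nonzero constant.\<close>

definition stretch :: "'k \<Rightarrow> real \<Rightarrow> real^'k^'k" where
  "stretch i0 s = (\<chi> i j. if i = j then (if i = i0 then 1 / s ^ (CARD('k) - 1) else s) else 0)"

lemma vector_matrix_mult_stretch:
  "x v* stretch i0 s
    = (\<chi> j. x $ j * (if j = i0 then 1 / s ^ (CARD('k) - 1) else s))" for x :: "real^'k"
  by (simp add: vec_eq_iff vector_matrix_mult_def stretch_def if_distrib[of "\<lambda>c. _ * c"] cong: if_cong)

lemma det_stretch:
  assumes "s \<noteq> 0"
  shows "det (stretch i0 s :: real^'k^'k) = 1"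
proof -
  have "det (stretch i0 s :: real^'k^'k)
      = (\<Prod>i\<in>UNIV. if i = i0 then 1 / s ^ (CARD('k) - 1) else s)"
    by (subst det_diagonal) (auto simp: stretch_def)
  also have "\<dots> = 1 / s ^ (CARD('k) - 1) * (\<Prod>i\<in>UNIV - {i0}. s)"
    by (subst prod.remove[of _ i0]) (auto intro!: prod.cong)
  also have "\<dots> = 1" using assms by simp
  finally show ?thesis .
qed

lemma stretch_inverse:
  assumes "s \<noteq> 0"
  shows "x v* stretch i0 (1 / s) v* stretch i0 s = x"
  using assms by (simp add: vec_eq_iff vector_matrix_mult_stretch power_divide)

text \<open>Multiplying by \<open>s\<^sup>n\<close> gives a polynomial whose coefficient of \<open>s\<^sup>n\<close> is \<open>-R\<close>: for \<open>n > 0\<close> the other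
  terms have degrees \<open>n + 1\<close> and \<open>0\<close>.\<close>

lemma finite_solutions_stretched_form:
  fixes a b R :: real and n :: nat
  assumes "R \<noteq> 0" "n > 0"
  shows "finite {s. s > 0 \<and> R = a * s + b / s ^ n}"
proof -
  define p where "p = monom a (Suc n) - monom R n + [:b:]"
  have "coeff p n = - R" using assms by (simp add: p_def coeff_pCons split: nat.split)
  then have "p \<noteq> 0" using assms(1) by auto
  moreover have "{s. s > 0 \<and> R = a * s + b / s ^ n} \<subseteq> {s. poly p s = 0}"
  proof clarify
    fix s :: real assume s: "s > 0" "R = a * s + b / s ^ n"
    have "poly p s = a * s ^ Suc n - (a * s + b / s ^ n) * s ^ n + b"
      unfolding p_def using s(2) by (simp add: poly_monom)
    also have "\<dots> = 0" using s(1) by (simp add: algebra_simps)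
    finally show "poly p s = 0" .
  qed
  ultimately show ?thesis using poly_roots_finite finite_subset by blast
qed

lemma l1_norm_stretch_ge:
  fixes x :: "real^'k"
  assumes "1 \<le> s" "s \<le> 2"
  shows "l1_norm x \<le> 2 ^ (CARD('k) - 1) * l1_norm (x v* stretch i0 s)"
  unfolding l1_norm_def sum_distrib_left
proof (rule sum_mono)
  fix j :: 'k
  have "s ^ (CARD('k) - 1) \<le> 2 ^ (CARD('k) - 1)" using assms by (intro power_mono) auto
  moreover have "1 \<le> (2::real) ^ (CARD('k) - 1) * s"
    using mult_mono[of 1 "(2::real) ^ (CARD('k) - 1)" 1 s] assms by simp
  ultimately have "1 \<le> 2 ^ (CARD('k) - 1) * (if j = i0 then 1 / s ^ (CARD('k) - 1) else s)"
    using assms by simp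
  from mult_left_mono[OF this, of "\<bar>x $ j\<bar>"] assms
  show "\<bar>x $ j\<bar> \<le> 2 ^ (CARD('k) - 1) * \<bar>(x v* stretch i0 s) $ j\<bar>"
    by (simp add: vector_matrix_mult_stretch abs_mult mult.left_commute)
qed

text \<open>The curve distorts lengths by a bounded factor on \<open>[1,2]\<close>, so the integer vectors that occur in
  the linear forms for all these \<open>s\<close> come from one finite set \<open>Z\<close>. Each of the finitely many choices of
  a set of sign vectors \<open>E\<close> and integer vectors \<open>z\<close> then contributes a finite set \<open>T E z\<close>.\<close>

lemma finite_stretch_covering_radius:
  fixes M :: "real^'k^'k"
  assumes "CARD('k) \<ge> 2" "invertible M" "R > 0"
  shows "finite {s \<in> {1..2}. covering_radius cross_polytope (lattice_of (M ** stretch i0 s)) = R}"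
proof -
  define n where "n = CARD('k) - 1"
  have n: "n > 0" using assms(1) by (simp add: n_def)
  define Z where "Z = {z. z \<in> integer_vectors \<and> l1_norm (z v* M) \<le> 2 ^ n * (2 * R)}"
  have fin: "finite Z" unfolding Z_def by (rule finite_short_coordinates[OF assms(2)])
  define T where "T = (\<lambda>E z. {s. s > 0 \<and>
    R = (\<Sum>e\<in>E. balancing_weights E e * (e \<bullet> (z e v* M v* stretch i0 s)))})"
  have finT: "finite (T E z)" for E :: "(real^'k) set" and z
  proof -
    define c where "c = (\<lambda>j. \<Sum>e\<in>E. balancing_weights E e * (e $ j * (z e v* M) $ j))"
    have "(\<Sum>e\<in>E. balancing_weights E e * (e \<bullet> (z e v* M v* stretch i0 s)))
        = (\<Sum>j\<in>UNIV - {i0}. c j) * s + c i0 / s ^ n" for s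
    proof -
      have "(\<Sum>e\<in>E. balancing_weights E e * (e \<bullet> (z e v* M v* stretch i0 s)))
          = (\<Sum>j\<in>UNIV. c j * (if j = i0 then 1 / s ^ n else s))"
        unfolding inner_vec_def sum_distrib_left c_def sum_distrib_right
        by (subst sum.swap) (simp add: vector_matrix_mult_stretch n_def mult.assoc cong: if_cong)
      also have "\<dots> = c i0 / s ^ n + (\<Sum>j\<in>UNIV - {i0}. c j * s)"
        by (subst sum.remove[of _ i0]) (auto intro!: sum.cong)
      finally show ?thesis by (simp add: sum_distrib_right)
    qed
    then show ?thesis
      unfolding T_def using finite_solutions_stretched_form[of R n] assms(3) n by simp
  qed
  have "{s \<in> {1..2}. covering_radius cross_polytope (lattice_of (M ** stretch i0 s)) = R}
      \<subseteq> (\<Union>E\<in>Pow sign_vectors. \<Union>z\<in>E \<rightarrow>\<^sub>E Z. T E z)"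
  proof
    fix s :: real
    assume "s \<in> {s \<in> {1..2}. covering_radius cross_polytope (lattice_of (M ** stretch i0 s)) = R}"
    then have s: "s \<in> {1..2}" "covering_radius cross_polytope (lattice_of (M ** stretch i0 s)) = R"
      by auto
    have "invertible (M ** stretch i0 s)"
      using assms(2) s(1) by (simp add: invertible_det_nz det_mul det_stretch)
    then obtain E z where E: "E \<subseteq> sign_vectors"
      and z: "\<And>e. e \<in> E \<Longrightarrow> z e \<in> integer_vectors \<and> l1_norm (z e v* M v* stretch i0 s) \<le> 2 * R"
      and sum: "R = (\<Sum>e\<in>E. balancing_weights E e * (e \<bullet> (z e v* M v* stretch i0 s)))"
      using covering_radius_eq_linear_form[OF _ s(2) assms(3)]
      unfolding vector_matrix_mul_assoc by blast
    have "z e \<in> Z" if "e \<in> E" for e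
    proof -
      have "l1_norm (z e v* M) \<le> 2 ^ n * l1_norm (z e v* M v* stretch i0 s)"
        unfolding n_def using s(1) by (intro l1_norm_stretch_ge) auto
      also have "\<dots> \<le> 2 ^ n * (2 * R)" using z[OF that] by (intro mult_left_mono) auto
      finally show ?thesis using z[OF that] by (simp add: Z_def)
    qed
    then have "restrict z E \<in> E \<rightarrow>\<^sub>E Z" by auto
    moreover have "s \<in> T E (restrict z E)" using s(1) sum by (simp add: T_def)
    ultimately show "s \<in> (\<Union>E\<in>Pow sign_vectors. \<Union>z\<in>E \<rightarrow>\<^sub>E Z. T E z)" using E by blast
  qed
  moreover have "finite (\<Union>E\<in>Pow sign_vectors. \<Union>z\<in>E \<rightarrow>\<^sub>E Z. T E z)"
  proof (intro finite_UN_I)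
    show "finite (Pow sign_vectors :: (real^'k) set set)" by simp
    show "finite (E \<rightarrow>\<^sub>E Z)" if "E \<in> Pow sign_vectors" for E
      using that fin finite_subset[OF _ finite_sign_vectors] by (intro finite_PiE) auto
  qed (rule finT)
  ultimately show ?thesis by (rule finite_subset)
qed

section \<open>Measurability of the level sets\<close>


text \<open>A matrix close to the identity changes the norm by a factor close to \<open>1\<close>. The same factor controls
  the change of the covering radius in \<open>covers_mult\<close>, which makes it upper semicontinuous.\<close>

lemma l1_norm_perturb_le:
  fixes H :: "real^'k^'k"
  shows "l1_norm (x v* H) \<le> (1 + (\<Sum>i\<in>UNIV. l1_norm ((H - mat 1) $ i))) * l1_norm x"
proof -
  have "x v* H = x + x v* (H - mat 1)" by (simp add: vector_matrix_mult_diff_rdistrib)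
  then have "l1_norm (x v* H) \<le> l1_norm x + l1_norm (x v* (H - mat 1))"
    by (metis l1_norm_triangle)
  with l1_norm_vector_matrix_le[of x "H - mat 1"] show ?thesis by (simp add: algebra_simps)
qed

lemma covers_mult:
  fixes N H :: "real^'k^'k"
  assumes "covers r (lattice_of N)" "invertible H"
  shows "covers ((1 + (\<Sum>i\<in>UNIV. l1_norm ((H - mat 1) $ i))) * r) (lattice_of (N ** H))"
  unfolding covers_def
proof
  fix y
  obtain H' where H': "H' ** H = mat 1" using assms(2) by (auto simp: invertible_def)
  obtain v where v: "v \<in> lattice_of N" "l1_norm (y v* H' - v) \<le> r"
    using assms(1) by (auto simp: covers_def)
  have "y - v v* H = (y v* H' - v) v* H"
    by (simp add: vector_matrix_mult_diff_distrib vector_matrix_mul_assoc H')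
  then have "l1_norm (y - v v* H)
      \<le> (1 + (\<Sum>i\<in>UNIV. l1_norm ((H - mat 1) $ i))) * l1_norm (y v* H' - v)"
    by (simp only: l1_norm_perturb_le)
  also have "\<dots> \<le> (1 + (\<Sum>i\<in>UNIV. l1_norm ((H - mat 1) $ i))) * r"
    using v(2) by (intro mult_left_mono) (simp_all add: add_nonneg_nonneg sum_nonneg)
  finally have "l1_norm (y - v v* H) \<le> (1 + (\<Sum>i\<in>UNIV. l1_norm ((H - mat 1) $ i))) * r" .
  moreover have "v v* H \<in> lattice_of (N ** H)"
    using v(1) by (auto simp: lattice_of_def vector_matrix_mul_assoc)
  ultimately show "\<exists>w\<in>lattice_of (N ** H).
      l1_norm (y - w) \<le> (1 + (\<Sum>i\<in>UNIV. l1_norm ((H - mat 1) $ i))) * r" by blast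
qed

lemma open_covering_radius_less:
  fixes N :: "real^'k^'k"
  assumes N: "N \<in> SL_real" and less: "covering_radius cross_polytope (lattice_of N) < r"
  obtains U where "open U" "N \<in> U"
    "\<And>M. M \<in> U \<Longrightarrow> M \<in> SL_real \<Longrightarrow> covering_radius cross_polytope (lattice_of M) < r"
proof -
  have inv: "invertible N" using N by (simp add: SL_real_def invertible_det_nz)
  then obtain N' where N': "N ** N' = mat 1" "N' ** N = mat 1" by (auto simp: invertible_def)
  have det': "det N' = 1" using arg_cong[OF N'(1), of det] N by (simp add: det_mul SL_real_def)
  obtain s where s: "0 < s" "s < r" "covers s (lattice_of N)"
    using covers_below[OF inv less] .
  define f where "f M = (1 + (\<Sum>i\<in>UNIV. l1_norm ((N' ** M - mat 1) $ i))) * s" for M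
  have "continuous_on UNIV f"
    unfolding f_def l1_norm_def matrix_matrix_mult_def by (simp, intro continuous_intros)
  then have "open {M. f M < r}" by (intro open_Collect_less continuous_on_const)
  moreover have "N \<in> {M. f M < r}" using s by (simp add: f_def N' l1_norm_def)
  moreover have "covering_radius cross_polytope (lattice_of M) < r"
    if M: "M \<in> {M. f M < r}" "M \<in> SL_real" for M
  proof -
    have "invertible (N' ** M)" using M det' by (simp add: invertible_det_nz det_mul SL_real_def)
    from covers_mult[OF s(3) this] have "covers (f M) (lattice_of M)"
      by (simp add: f_def matrix_mul_assoc N')
    moreover have "f M > 0"
      unfolding f_def using s(1) by (intro mult_pos_pos add_pos_nonneg) (simp_all add: sum_nonneg)
    ultimately show ?thesis using covering_radius_le M(1) by fastforce
  qed
  ultimately show thesis by (rule that)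
qed

text \<open>The sublevel sets \<open>{\<rho> < r}\<close> are open by upper semicontinuity, and they generate the level sets:
  \<open>{\<rho> = R}\<close> is \<open>\<Inter>\<^sub>n {\<rho> < R + 1/(n+1)}\<close> without \<open>{\<rho> < R}\<close>.\<close>

lemma level_set_in_sets_lattice_borel:
  "{L \<in> (unimodular_lattices :: (real^'k) set set). covering_radius cross_polytope L = R} \<in> sets lattice_borel"
proof -
  let ?U = "\<lambda>r. {L \<in> (unimodular_lattices :: (real^'k) set set). covering_radius cross_polytope L < r}"
  have "openin lattice_topology (?U r)" for r
    unfolding openin_lattice_topology
  proof
    have eq: "{M \<in> SL_real. lattice_of M \<in> ?U r}
        = {M \<in> SL_real. covering_radius cross_polytope (lattice_of M) < r}"
      by (auto simp: unimodular_lattices_eq)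
    show "openin (top_of_set SL_real) {M \<in> SL_real. lattice_of M \<in> ?U r}"
      unfolding eq
    proof (subst openin_subopen, clarify)
      fix N :: "real^'k^'k"
      assume N: "N \<in> SL_real" "covering_radius cross_polytope (lattice_of N) < r"
      then obtain U where U: "open U" "N \<in> U"
        "\<And>M. M \<in> U \<Longrightarrow> M \<in> SL_real \<Longrightarrow> covering_radius cross_polytope (lattice_of M) < r"
        using open_covering_radius_less by metis
      then show "\<exists>T. openin (top_of_set SL_real) T \<and> N \<in> T \<and>
          T \<subseteq> {M \<in> SL_real. covering_radius cross_polytope (lattice_of M) < r}"
        using N(1) by (intro exI[of _ "SL_real \<inter> U"]) (auto intro: openin_open_Int)
    qed
  qed auto
  then have U: "?U r \<in> sets lattice_borel" for r
    unfolding lattice_borel_def by (auto simp: sets_measure_of_conv openin_lattice_topology)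
  have "{L \<in> unimodular_lattices. covering_radius cross_polytope L = R}
      = (\<Inter>n. ?U (R + 1 / real (Suc n))) - ?U R"
  proof (intro equalityI subsetI)
    fix L :: "(real^'k) set"
    assume L: "L \<in> (\<Inter>n. ?U (R + 1 / real (Suc n))) - ?U R"
    have "covering_radius cross_polytope L \<le> R"
    proof (rule field_le_epsilon)
      fix d :: real assume "d > 0"
      then obtain n where "inverse (real (Suc n)) < d" using reals_Archimedean by auto
      moreover have "covering_radius cross_polytope L < R + 1 / real (Suc n)" using L by blast
      ultimately show "covering_radius cross_polytope L \<le> R + d" by (simp add: inverse_eq_divide)
    qed
    then show "L \<in> {L \<in> unimodular_lattices. covering_radius cross_polytope L = R}" using L by auto
  qed auto
  also have "\<dots> \<in> sets lattice_borel"
    using U by (intro sets.Diff sets.countable_INT) auto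
  finally show ?thesis .
qed

section \<open>Infinitely many translates of equal measure\<close>

text \<open>The upper limit of the \<open>A n\<close> is empty, but by continuity from above it has measure at least \<open>c\<close>.\<close>

lemma (in finite_measure) emeasure_zero_if_finitely_often:
  fixes A :: "nat \<Rightarrow> 'a set"
  assumes sets: "\<And>n. A n \<in> sets M" and c: "\<And>n. c \<le> emeasure M (A n)"
    and fin: "\<And>x. x \<in> space M \<Longrightarrow> finite {n. x \<in> A n}"
  shows "c = 0"
proof -
  define B where "B m = (\<Union>n\<in>{m..}. A n)" for m
  have B: "range B \<subseteq> sets M" using sets by (auto simp: B_def)
  have "decseq B" unfolding decseq_def B_def by (intro allI impI UN_mono) auto
  have "x \<notin> (\<Inter>m. B m)" for x
  proof
    assume x: "x \<in> (\<Inter>m. B m)"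
    then have "x \<in> space M" using B sets.sets_into_space by blast
    then obtain k where k: "\<And>n. x \<in> A n \<Longrightarrow> n < k"
      using fin[of x] unfolding finite_nat_set_iff_bounded by auto
    from x have "x \<in> B k" by blast
    with k show False by (fastforce simp: B_def)
  qed
  then have "(\<Inter>m. B m) = {}" by blast
  then have "(INF m. emeasure M (B m)) = 0"
    using INF_emeasure_decseq[OF B \<open>decseq B\<close>] by simp
  moreover have "c \<le> emeasure M (B m)" for m
    using c[of m] by (rule order_trans) (use B in \<open>auto intro!: emeasure_mono simp: B_def\<close>)
  then have "c \<le> (INF m. emeasure M (B m))" by (rule INF_greatest)
  ultimately show ?thesis by simp
qed

theorem lemma7:
  fixes \<mu>\<^sub>0 :: "(real^'k) set measure" and R :: real
  assumes "CARD('k) \<ge> 2"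
    and "invariant_probability \<mu>\<^sub>0"
    and "R > 0"
  shows "{L \<in> unimodular_lattices. covering_radius cross_polytope L = R} \<in> null_sets \<mu>\<^sub>0"
proof -
  interpret prob_space \<mu>\<^sub>0 using assms(2) by (simp add: invariant_probability_def)
  let ?S = "{L \<in> (unimodular_lattices :: (real^'k) set set). covering_radius cross_polytope L = R}"
  have S: "?S \<in> sets \<mu>\<^sub>0"
    using assms(2) level_set_in_sets_lattice_borel by (simp add: invariant_probability_def)
  define i0 :: 'k where "i0 = undefined"
  define s where "s n = 1 + 1 / real (Suc n)" for n
  have s: "s n \<in> {1..2}" "s n \<noteq> 0" for n by (auto simp: s_def field_simps)
  have "inj s" by (simp add: inj_on_def s_def)
  define A where "A n = lattice_action (stretch i0 (1 / s n)) ` ?S" for n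
  have A: "emeasure \<mu>\<^sub>0 (A n) = emeasure \<mu>\<^sub>0 ?S" for n
  proof -
    have "stretch i0 (1 / s n) \<in> SL_real" using s(2) by (simp add: SL_real_def det_stretch)
    with assms(2) S show ?thesis by (simp add: A_def invariant_probability_def)
  qed
  have fin: "finite {n. L \<in> A n}" if "L \<in> space \<mu>\<^sub>0" for L
  proof -
    have "space \<mu>\<^sub>0 = space lattice_borel"
      using assms(2) by (intro sets_eq_imp_space_eq) (simp add: invariant_probability_def)
    with that have "L \<in> unimodular_lattices"
      by (simp add: lattice_borel_def space_measure_of_conv)
    then obtain M where M: "M \<in> SL_real" "L = lattice_of M" by (auto simp: unimodular_lattices_eq)
    let ?T = "{t \<in> {1..2}. covering_radius cross_polytope (lattice_of (M ** stretch i0 t)) = R}"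
    have "s n \<in> ?T" if n: "L \<in> A n" for n
    proof -
      obtain L' where L': "L = lattice_action (stretch i0 (1 / s n)) L'"
        "covering_radius cross_polytope L' = R"
        using n by (auto simp: A_def)
      have "lattice_of (M ** stretch i0 (s n)) = (\<lambda>x. x v* stretch i0 (s n)) ` L"
        unfolding M(2) lattice_of_def image_image vector_matrix_mul_assoc ..
      also have "\<dots> = L'"
        using s(2) by (simp add: L'(1) lattice_action_def image_image stretch_inverse)
      finally show ?thesis using L'(2) s(1) by simp
    qed
    then have "{n. L \<in> A n} \<subseteq> s -` ?T" by blast
    moreover have "invertible M" using M(1) by (simp add: SL_real_def invertible_det_nz)
    then have "finite (s -` ?T)"
      using assms(1,3) \<open>inj s\<close> by (intro finite_vimageI finite_stretch_covering_radius)
    ultimately show ?thesis by (rule finite_subset)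
  qed
  have "emeasure \<mu>\<^sub>0 ?S = 0"
  proof (rule ccontr)
    assume nz: "emeasure \<mu>\<^sub>0 ?S \<noteq> 0"
    \<comment> \<open>A non-measurable set has \<open>emeasure\<close> zero by convention, so equality of the measures suffices.\<close>
    have "A n \<in> sets \<mu>\<^sub>0" for n
      using A[of n] nz emeasure_notin_sets[of "A n" \<mu>\<^sub>0] by (cases "A n \<in> sets \<mu>\<^sub>0") simp_all
    then have "emeasure \<mu>\<^sub>0 ?S = 0"
      by (rule emeasure_zero_if_finitely_often[of A]) (simp_all only: A fin order_refl)
    with nz show False ..
  qed
  with S show ?thesis by auto
qed

end
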